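(* Let $\mathfrak{r}$ be the $3$-dimensional complex Lie algebra with basis $(e_1,e_2,e_3)$ and non-zero Lie brackets (up to antisymmetry) $[e_1,e_2]=e_2$ and $[e_1,e_3]=e_2+e_3$. Every commutative post-Lie algebra structure on $\mathfrak{r}$ is isomorphic to one of the following structures $B_1,B_2,B_3,B_4$, given by the matrices, with respect to the basis $(e_1,e_2,e_3)$, of the left multiplication operators $L(e_i)$: (1) $L(e_1)=0$, $L(e_2)=0$, $L(e_3)=0$. (2) $L(e_1)=\begin{pmatrix}0&0&0\\1&0&0\\0&0&0\end{pmatrix}$, $L(e_2)=0$, $L(e_3)=0$. (3) $L(e_1)=\begin{pmatrix}0&0&0\\0&0&0\\1&0&0\end{pmatrix}$, $L(e_2)=0$, $L(e_3)=0$. (4) $L(e_1)=\begin{pmatrix}0&0&0\\0&1&1\\0&0&1\end{pmatrix}$, $L(e_2)=\begin{pmatrix}0&0&0\\1&0&0\\0&0&0\end{pmatrix}$, $L(e_3)=\begin{pmatrix}0&0&0\\1&0&0\\1&0&0\end{pmatrix}$.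
   Context: A commutative post-Lie algebra structure on a Lie algebra $\mathfrak{g}$ is a bilinear product $\mathfrak{g}\times\mathfrak{g}\to\mathfrak{g}$, $(x,y)\mapsto x\cdot y$, such that for all $x,y,z\in\mathfrak{g}$: $x\cdot y=y\cdot x$; $[x,y]\cdot z=x\cdot(y\cdot z)-y\cdot(x\cdot z)$; $x\cdot[y,z]=[x\cdot y,z]+[y,x\cdot z]$. The left multiplication operators are $L(x)(y)=x\cdot y$; matrices act on column vectors (the $j$-th column of $L(e_i)$ contains the coordinates of $e_i\cdot e_j$). Two commutative post-Lie algebra structures $\cdot$ and $\circ$ on $\mathfrak{g}$ are isomorphic if there is a bijective linear map $\varphi\colon\mathfrak{g}\to\mathfrak{g}$ with $\varphi(x\cdot y)=\varphi(x)\circ\varphi(y)$ and $\varphi([x,y])=[\varphi(x),\varphi(y)]$ for all $x,y\in\mathfrak{g}$. *)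

theory Defs
  imports "HOL-Analysis.Analysis"
begin

definition bilinear_on ::
    "('k::field \<Rightarrow> 'v::ab_group_add \<Rightarrow> 'v) \<Rightarrow> ('v \<Rightarrow> 'v \<Rightarrow> 'v) \<Rightarrow> bool" where
  "bilinear_on smul f \<longleftrightarrow>
     (\<forall>x. Vector_Spaces.linear smul smul (\<lambda>y. f x y)) \<and>
     (\<forall>y. Vector_Spaces.linear smul smul (\<lambda>x. f x y))"

locale lie_algebra = vector_space smul
  for smul :: "'k::field \<Rightarrow> 'v::ab_group_add \<Rightarrow> 'v" +
  fixes bracket :: "'v \<Rightarrow> 'v \<Rightarrow> 'v"
  assumes bracket_bilinear: "bilinear_on smul bracket"
    and bracket_self: "bracket x x = 0"
    and jacobi:
      "bracket x (bracket y z) + bracket y (bracket z x) + bracket z (bracket x y) = 0"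

locale commutative_post_lie = lie_algebra smul bracket
  for smul :: "'k::field \<Rightarrow> 'v::ab_group_add \<Rightarrow> 'v"
    and bracket :: "'v \<Rightarrow> 'v \<Rightarrow> 'v" +
  fixes prd :: "'v \<Rightarrow> 'v \<Rightarrow> 'v"
  assumes prd_bilinear: "bilinear_on smul prd"
    and prd_commute: "prd x y = prd y x"
    and prd_bracket_left: "prd (bracket x y) z = prd x (prd y z) - prd y (prd x z)"
    and prd_bracket_right: "prd x (bracket y z) = bracket (prd x y) z + bracket y (prd x z)"

definition cpa_isomorphic ::
    "('k::field \<Rightarrow> 'v::ab_group_add \<Rightarrow> 'v) \<Rightarrow> ('v \<Rightarrow> 'v \<Rightarrow> 'v) \<Rightarrow>
     ('v \<Rightarrow> 'v \<Rightarrow> 'v) \<Rightarrow> ('v \<Rightarrow> 'v \<Rightarrow> 'v) \<Rightarrow> bool" where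
  "cpa_isomorphic smul bracket p q \<longleftrightarrow>
     (\<exists>\<phi>. Vector_Spaces.linear smul smul \<phi> \<and> bij \<phi> \<and>
        (\<forall>x y. \<phi> (p x y) = q (\<phi> x) (\<phi> y)) \<and>
        (\<forall>x y. \<phi> (bracket x y) = bracket (\<phi> x) (\<phi> y)))"

text \<open>The Lie algebra \<open>\<rr>\<close> is realised on \<open>complex ^ 3\<close>, with \<open>e i\<close> the standard basis.
  Linearity is always taken over the complex numbers, i.e. with respect to the scalar
  multiplication \<open>(*s)\<close>; the class-based constant \<open>linear\<close> would mean real linearity.\<close>

abbreviation e :: "3 \<Rightarrow> complex ^ 3" where
  "e i \<equiv> axis i 1"

text \<open>The bilinear antisymmetric extension of \<open>[e 1, e 2] = e 2\<close>, \<open>[e 1, e 3] = e 2 + e 3\<close>,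
  \<open>[e 2, e 3] = 0\<close>.\<close>

definition r_bracket :: "complex ^ 3 \<Rightarrow> complex ^ 3 \<Rightarrow> complex ^ 3" where
  "r_bracket x y =
     (x $ 1 * y $ 2 - x $ 2 * y $ 1) *s e 2 + (x $ 1 * y $ 3 - x $ 3 * y $ 1) *s (e 2 + e 3)"

lemma r_bracket_basis:
  "r_bracket (e 1) (e 2) = e 2"
  "r_bracket (e 1) (e 3) = e 2 + e 3"
  "r_bracket (e 2) (e 3) = 0"
  by (simp_all add: r_bracket_def vec_eq_iff forall_3 axis_def)

lemma lie_algebra_r: "lie_algebra (*s) r_bracket"
proof -
  have vs: "vector_space ((*s) :: complex \<Rightarrow> complex ^ 3 \<Rightarrow> complex ^ 3)"
    by unfold_locales
  have "bilinear_on (*s) r_bracket"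
    unfolding bilinear_on_def
    by (auto simp: Vector_Spaces.linear_iff vs r_bracket_def vec_eq_iff forall_3 axis_def
        algebra_simps)
  then show ?thesis
    by unfold_locales (auto simp: r_bracket_def vec_eq_iff forall_3 axis_def algebra_simps)
qed

text \<open>The product whose left multiplication operators \<open>L (e 1)\<close>, \<open>L (e 2)\<close>, \<open>L (e 3)\<close> have the
  given matrices: \<open>x \<cdot> y = L x y\<close> with \<open>L x = (\<Sum>i. x $ i *s L (e i))\<close>.\<close>

definition product_of_matrices ::
    "complex ^ 3 ^ 3 \<Rightarrow> complex ^ 3 ^ 3 \<Rightarrow> complex ^ 3 ^ 3 \<Rightarrow>
     complex ^ 3 \<Rightarrow> complex ^ 3 \<Rightarrow> complex ^ 3" where
  "product_of_matrices L1 L2 L3 x y =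
     x $ 1 *s (L1 *v y) + x $ 2 *s (L2 *v y) + x $ 3 *s (L3 *v y)"

lemma product_of_matrices_basis:
  "product_of_matrices L1 L2 L3 (e 1) y = L1 *v y"
  "product_of_matrices L1 L2 L3 (e 2) y = L2 *v y"
  "product_of_matrices L1 L2 L3 (e 3) y = L3 *v y"
  by (simp_all add: product_of_matrices_def axis_def vec_eq_iff)

text \<open>Matrices are listed by rows.\<close>

abbreviation matrix3 :: "complex list list \<Rightarrow> complex ^ 3 ^ 3" where
  "matrix3 xss \<equiv> vector (map vector xss)"

definition B1 :: "complex ^ 3 \<Rightarrow> complex ^ 3 \<Rightarrow> complex ^ 3" where
  "B1 = product_of_matrices 0 0 0"

definition B2 :: "complex ^ 3 \<Rightarrow> complex ^ 3 \<Rightarrow> complex ^ 3" where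
  "B2 = product_of_matrices
     (matrix3 [[0, 0, 0],
               [1, 0, 0],
               [0, 0, 0]])
     0
     0"

definition B3 :: "complex ^ 3 \<Rightarrow> complex ^ 3 \<Rightarrow> complex ^ 3" where
  "B3 = product_of_matrices
     (matrix3 [[0, 0, 0],
               [0, 0, 0],
               [1, 0, 0]])
     0
     0"

definition B4 :: "complex ^ 3 \<Rightarrow> complex ^ 3 \<Rightarrow> complex ^ 3" where
  "B4 = product_of_matrices
     (matrix3 [[0, 0, 0],
               [0, 1, 1],
               [0, 0, 1]])
     (matrix3 [[0, 0, 0],
               [1, 0, 0],
               [0, 0, 0]])
     (matrix3 [[0, 0, 0],
               [1, 0, 0],
               [1, 0, 0]])"

end

theory Submission
  imports Defs
begin

text \<open>Every \<open>L x\<close> is a derivation of \<open>\<rr>\<close>. Such a derivation maps \<open>\<rr>\<close> into the span of \<open>e 2\<close>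
  and \<open>e 3\<close> and acts on that span as \<open>c I + d N\<close> with \<open>N\<close> nilpotent. Commutativity and the rule
  for \<open>[x, y] \<cdot> z\<close> then leave a family with one free vector \<open>e 1 \<cdot> e 1 = a e 2 + b e 3\<close> and one
  parameter \<open>c \<in> {0, 1}\<close>, where \<open>e 1\<close> acts on the span as \<open>c\<close> times \<open>ad (e 1)\<close>. If \<open>c = 0\<close>, the
  automorphisms commuting with \<open>ad (e 1)\<close> normalise \<open>e 1 \<cdot> e 1\<close> to \<open>0\<close>, \<open>e 2\<close> or \<open>e 3\<close>; if \<open>c = 1\<close>,
  a translation of \<open>e 1\<close> removes it.\<close>

definition cpa_family ::
    "complex \<Rightarrow> complex \<Rightarrow> complex \<Rightarrow> complex ^ 3 \<Rightarrow> complex ^ 3 \<Rightarrow> complex ^ 3" where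
  "cpa_family a b c x y =
     vector [0,
       a * x $ 1 * y $ 1 + c * (x $ 1 * (y $ 2 + y $ 3) + (x $ 2 + x $ 3) * y $ 1),
       b * x $ 1 * y $ 1 + c * (x $ 1 * y $ 3 + x $ 3 * y $ 1)]"

text \<open>On the span of \<open>e 2\<close> and \<open>e 3\<close> this is
  \<open>f I + g N\<close>, where \<open>N\<close> sends \<open>e 3\<close> to \<open>e 2\<close>
  and \<open>e 2\<close> to \<open>0\<close>, so it commutes with \<open>ad (e 1)\<close>;
  \<open>e 1\<close> is translated by \<open>w = u e 2 + v e 3\<close>.\<close>

definition r_automorphism ::
    "complex \<Rightarrow> complex \<Rightarrow> complex \<Rightarrow> complex \<Rightarrow> complex ^ 3 \<Rightarrow> complex ^ 3" where
  "r_automorphism u v f g x =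
     vector [x $ 1, u * x $ 1 + f * x $ 2 + g * x $ 3, v * x $ 1 + f * x $ 3]"

lemma axis_component: "axis i a $ j = (if j = i then a else 0)"
  by (simp add: axis_def)

lemma B_eq_cpa_family:
  "B1 = cpa_family 0 0 0" "B2 = cpa_family 1 0 0"
  "B3 = cpa_family 0 1 0" "B4 = cpa_family 0 0 1"
  by (auto simp: fun_eq_iff B1_def B2_def B3_def B4_def cpa_family_def
      product_of_matrices_def vec_eq_iff forall_3 matrix_vector_mult_def sum_3 algebra_simps)

lemma r_bracket_component:
  "r_bracket x y $ 1 = 0"
  "r_bracket x y $ 2 = x $ 1 * y $ 2 - x $ 2 * y $ 1 + (x $ 1 * y $ 3 - x $ 3 * y $ 1)"
  "r_bracket x y $ 3 = x $ 1 * y $ 3 - x $ 3 * y $ 1"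
  by (simp_all add: r_bracket_def axis_component)

lemma linear_smult_iff:
  "Vector_Spaces.linear (*s) (*s) (h :: complex ^ 3 \<Rightarrow> complex ^ 3) \<longleftrightarrow>
     (\<forall>x y. h (x + y) = h x + h y) \<and> (\<forall>k x. h (k *s x) = k *s h x)"
  by (auto simp: Vector_Spaces.linear_iff vec.vector_space_axioms)

text \<open>Only the rule for \<open>[x, y] \<cdot> z\<close> restricts \<open>c\<close>: at
  \<open>e 1, e 2, e 1\<close> it reads \<open>c = c * c\<close>.\<close>

lemma commutative_post_lie_cpa_family:
  assumes "c = 0 \<or> c = 1"
  shows "commutative_post_lie (*s) r_bracket (cpa_family a b c)"
proof -
  interpret lie_algebra "(*s)" r_bracket
    by (rule lie_algebra_r)
  have "bilinear_on (*s) (cpa_family a b c)"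
    by (simp add: bilinear_on_def linear_smult_iff cpa_family_def vec_eq_iff forall_3
        algebra_simps)
  moreover have "cpa_family a b c x y = cpa_family a b c y x" for x y
    by (simp add: cpa_family_def vec_eq_iff forall_3 algebra_simps)
  moreover have "cpa_family a b c (r_bracket x y) z =
      cpa_family a b c x (cpa_family a b c y z) - cpa_family a b c y (cpa_family a b c x z)"
    for x y z
    using assms
    by (elim disjE; simp add: cpa_family_def r_bracket_def vec_eq_iff forall_3 axis_component
        algebra_simps)
  moreover have "cpa_family a b c x (r_bracket y z) =
      r_bracket (cpa_family a b c x y) z + r_bracket y (cpa_family a b c x z)" for x y z
    by (simp add: cpa_family_def r_bracket_def vec_eq_iff forall_3 axis_component algebra_simps)
  ultimately show ?thesis
    by unfold_locales
qed

lemma linear_r_automorphism: "Vector_Spaces.linear (*s) (*s) (r_automorphism u v f g)"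
  by (simp add: linear_smult_iff r_automorphism_def vec_eq_iff forall_3 algebra_simps)

lemma bij_r_automorphism:
  assumes "f \<noteq> 0"
  shows "bij (r_automorphism u v f g)"
proof (rule o_bij)
  \<comment> \<open>On the span, \<open>f I + g N\<close> has inverse
    \<open>(1 / f) I - (g / f\<^sup>2) N\<close>; the new translation is minus the image of
    \<open>w\<close> under this inverse.\<close>
  let ?h = "r_automorphism ((g * v / f - u) / f) (- v / f) (1 / f) (- g / f\<^sup>2)"
  show "?h \<circ> r_automorphism u v f g = id" "r_automorphism u v f g \<circ> ?h = id"
    using assms
    by (simp_all add: fun_eq_iff r_automorphism_def vec_eq_iff forall_3 field_simps
        power2_eq_square)
qed

lemma r_automorphism_bracket:
  "r_automorphism u v f g (r_bracket x y) =
     r_bracket (r_automorphism u v f g x) (r_automorphism u v f g y)"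
  by (simp add: r_automorphism_def r_bracket_def vec_eq_iff forall_3 axis_component algebra_simps)

text \<open>The image of \<open>e 1\<close> is \<open>e 1 + w\<close>, whose square under the new
  product is \<open>a' e 2 + b' e 3 + 2 c [e 1, w]\<close> with
  \<open>[e 1, w] = (u + v) e 2 + v e 3\<close>. It must equal the image of
  \<open>a e 2 + b e 3\<close>.\<close>

lemma cpa_isomorphic_family:
  assumes "f \<noteq> 0"
    and a': "a' = f * a + g * b - 2 * c * (u + v)"
    and b': "b' = f * b - 2 * c * v"
  shows "cpa_isomorphic (*s) r_bracket (cpa_family a b c) (cpa_family a' b' c)"
  unfolding cpa_isomorphic_def
proof (intro exI conjI allI)
  let ?\<phi> = "r_automorphism u v f g"
  show "Vector_Spaces.linear (*s) (*s) ?\<phi>"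
    by (rule linear_r_automorphism)
  show "bij ?\<phi>"
    using assms(1) by (rule bij_r_automorphism)
  show "?\<phi> (r_bracket x y) = r_bracket (?\<phi> x) (?\<phi> y)" for x y
    by (rule r_automorphism_bracket)
  show "?\<phi> (cpa_family a b c x y) = cpa_family a' b' c (?\<phi> x) (?\<phi> y)" for x y
    unfolding a' b' r_automorphism_def cpa_family_def vec_eq_iff forall_3
    by (simp add: algebra_simps)
qed

lemma vec3_basis_expansion: "x = x $ 1 *s e 1 + x $ 2 *s e 2 + x $ 3 *s e 3"
  by (simp add: vec_eq_iff forall_3 axis_component)

text \<open>Coordinates of the Leibniz rule at \<open>[e 1, e 2]\<close> and
  \<open>[e 1, e 3]\<close> show that \<open>D (e 1)\<close> has no \<open>e 1\<close> part. Then
  \<open>D\<close> commutes on the span with \<open>ad (e 1)\<close>, a single Jordan block, and so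
  is a polynomial in it.\<close>

lemma r_derivation_form:
  assumes lin: "Vector_Spaces.linear (*s) (*s) D"
    and der: "\<And>x y. D (r_bracket x y) = r_bracket (D x) y + r_bracket x (D y)"
  obtains a b c d where
    "\<And>x. D x = vector [0, a * x $ 1 + c * x $ 2 + d * x $ 3, b * x $ 1 + c * x $ 3]"
proof -
  have add: "D (x + y) = D x + D y" and smult: "D (k *s x) = k *s D x" for k x y
    using lin by (auto simp: linear_smult_iff)
  have expand: "D x = x $ 1 *s D (e 1) + x $ 2 *s D (e 2) + x $ 3 *s D (e 3)" for x
    using arg_cong[OF vec3_basis_expansion[of x], of D] by (simp only: add smult)
  have e2: "D (e 2) = r_bracket (D (e 1)) (e 2) + r_bracket (e 1) (D (e 2))"
    using der[of "e 1" "e 2"] by (simp only: r_bracket_basis)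
  have e3: "D (e 2) + D (e 3) = r_bracket (D (e 1)) (e 3) + r_bracket (e 1) (D (e 3))"
    using der[of "e 1" "e 3"] by (simp only: r_bracket_basis add)
  have "D (e 2) $ 1 = 0"
    using arg_cong[OF e2, of "\<lambda>v. v $ 1"] by (simp add: r_bracket_component axis_component)
  moreover from this have "D (e 3) $ 1 = 0"
    using arg_cong[OF e3, of "\<lambda>v. v $ 1"] by (simp add: r_bracket_component axis_component)
  moreover have s: "D (e 2) $ 3 = D (e 1) $ 1"
    using arg_cong[OF e3, of "\<lambda>v. v $ 3"] by (simp add: r_bracket_component axis_component)
  \<comment> \<open>The coordinate used here gives \<open>D (e 1) $ 1 + D (e 2) $ 3 = 0\<close>,
    which with \<open>s\<close> becomes \<open>2 * D (e 1) $ 1 = 0\<close>.\<close>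
  moreover from s have "D (e 1) $ 1 = 0"
    using arg_cong[OF e2, of "\<lambda>v. v $ 2"] by (simp add: r_bracket_component axis_component)
  moreover from this have "D (e 3) $ 3 = D (e 2) $ 2"
    using arg_cong[OF e3, of "\<lambda>v. v $ 2"] by (simp add: r_bracket_component axis_component)
  ultimately have "D x = vector [0, D (e 1) $ 2 * x $ 1 + D (e 2) $ 2 * x $ 2 + D (e 3) $ 2 * x $ 3,
      D (e 1) $ 3 * x $ 1 + D (e 2) $ 2 * x $ 3]" for x
    by (simp add: expand[of x] vec_eq_iff forall_3 algebra_simps)
  then show ?thesis
    by (rule that)
qed

lemma commutative_post_lie_imp_cpa_family:
  assumes "commutative_post_lie (*s) r_bracket p"
  obtains a b c where "p = cpa_family a b c" "c = 0 \<or> c = 1"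
proof -
  interpret commutative_post_lie "(*s)" r_bracket p
    by (rule assms)
  have lin: "Vector_Spaces.linear (*s) (*s) (p x)" for x
    using prd_bilinear by (simp add: bilinear_on_def)
  have linl: "Vector_Spaces.linear (*s) (*s) (\<lambda>x. p x y)" for y
    using prd_bilinear by (simp add: bilinear_on_def)
  have add: "p (x + y) z = p x z + p y z" and smult: "p (k *s x) z = k *s p x z" for k x y z
    using linl by (auto simp: linear_smult_iff)
  have form: "\<exists>a b c d. \<forall>y. p x y =
      vector [0, a * y $ 1 + c * y $ 2 + d * y $ 3, b * y $ 1 + c * y $ 3]" for x
    by (rule r_derivation_form[OF lin prd_bracket_right]) blast
  obtain a1 b1 c1 d1 where p1: "\<And>y. p (e 1) y =
      vector [0, a1 * y $ 1 + c1 * y $ 2 + d1 * y $ 3, b1 * y $ 1 + c1 * y $ 3]"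
    using form by blast
  obtain a2 b2 c2 d2 where p2: "\<And>y. p (e 2) y =
      vector [0, a2 * y $ 1 + c2 * y $ 2 + d2 * y $ 3, b2 * y $ 1 + c2 * y $ 3]"
    using form by blast
  obtain a3 b3 c3 d3 where p3: "\<And>y. p (e 3) y =
      vector [0, a3 * y $ 1 + c3 * y $ 2 + d3 * y $ 3, b3 * y $ 1 + c3 * y $ 3]"
    using form by blast
  have comm: "a2 = c1" "b2 = 0" "a3 = d1" "b3 = c1" "c2 = 0" "d2 = c3"
    using prd_commute[of "e 1" "e 2"] prd_commute[of "e 1" "e 3"] prd_commute[of "e 2" "e 3"]
    by (auto simp: p1 p2 p3 vec_eq_iff forall_3 axis_component)
  have bracket2: "p (e 2) z = p (e 1) (p (e 2) z) - p (e 2) (p (e 1) z)" for z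
    using prd_bracket_left[of "e 1" "e 2" z] by (simp only: r_bracket_basis)
  have bracket3: "p (e 2) z + p (e 3) z = p (e 1) (p (e 3) z) - p (e 3) (p (e 1) z)" for z
    using prd_bracket_left[of "e 1" "e 3" z] by (simp only: r_bracket_basis add)
  \<comment> \<open>On the span all left multiplications have the form \<open>c I + d N\<close> and
    commute, so the right sides of \<open>bracket2\<close> and \<open>bracket3\<close> vanish at
    \<open>e 3\<close>.\<close>
  have c3: "c3 = 0"
    using arg_cong[OF bracket2[of "e 3"], of "\<lambda>v. v $ 2"]
    by (simp add: p1 p2 comm axis_component algebra_simps)
  have d3: "d3 = 0"
    using arg_cong[OF bracket3[of "e 3"], of "\<lambda>v. v $ 2"]
    by (simp add: p1 p2 p3 comm c3 axis_component algebra_simps)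
  \<comment> \<open>The coordinate reads \<open>c1 = c1 * c1\<close>; the corresponding one of
    \<open>bracket3\<close> below reads \<open>c1 + d1 = 2 * c1 * d1\<close>.\<close>
  have c1: "c1 = 0 \<or> c1 = 1"
    using arg_cong[OF bracket2[of "e 1"], of "\<lambda>v. v $ 2"]
    by (simp add: p1 p2 comm c3 axis_component)
  then have d1: "d1 = c1"
    using arg_cong[OF bracket3[of "e 1"], of "\<lambda>v. v $ 2"]
    by (elim disjE; simp add: p1 p2 p3 comm c3 d3 axis_component)
  have expand: "p x y = x $ 1 *s p (e 1) y + x $ 2 *s p (e 2) y + x $ 3 *s p (e 3) y" for x y
    using arg_cong[OF vec3_basis_expansion[of x], of "\<lambda>x. p x y"] by (simp only: add smult)
  have "p x y = cpa_family a1 b1 c1 x y" for x y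
    by (simp add: expand[of x y] cpa_family_def p1 p2 p3 comm c3 d3 d1 vec_eq_iff forall_3 algebra_simps)
  then have "p = cpa_family a1 b1 c1"
    by (intro ext)
  then show ?thesis
    using c1 by (rule that)
qed

lemma cpa_family_isomorphic_B:
  assumes "c = 0 \<or> c = 1"
  shows "\<exists>B \<in> {B1, B2, B3, B4}. cpa_isomorphic (*s) r_bracket (cpa_family a b c) B"
proof -
  consider "c = 0" "b = 0" "a = 0" | "c = 0" "b = 0" "a \<noteq> 0" | "c = 0" "b \<noteq> 0" | "c = 1"
    using assms by blast
  then show ?thesis
  proof cases
    case 1
    then show ?thesis
      \<comment> \<open>The arguments are, in order, \<open>f a' a g b c u v b'\<close>.\<close>
      using cpa_isomorphic_family[of 1 0 0 0 0 0 0 0 0] by (simp add: B_eq_cpa_family)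
  next
    case 2
    then show ?thesis
      using cpa_isomorphic_family[of "1 / a" 1 a 0 0 0 0 0 0] by (simp add: B_eq_cpa_family)
  next
    case 3
    then show ?thesis
      \<comment> \<open>Scaling by \<open>1 / b\<close> makes \<open>b' = 1\<close>;
        \<open>g\<close> solves \<open>a / b + g * b = 0\<close>.\<close>
      using cpa_isomorphic_family[of "1 / b" 0 a "- a / b\<^sup>2" b 0 0 0 1]
      by (simp add: B_eq_cpa_family power2_eq_square)
  next
    case 4
    then show ?thesis
      \<comment> \<open>The translation solves \<open>2 [e 1, w] = a e 2 + b e 3\<close>.\<close>
      using cpa_isomorphic_family[of 1 0 a 0 b 1 "(a - b) / 2" "b / 2" 0]
      by (simp add: B_eq_cpa_family field_simps)
  qed
qed

theorem proposition6p2: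
  shows "(\<forall>B \<in> {B1, B2, B3, B4}. commutative_post_lie (*s) r_bracket B) \<and>
         (\<forall>p. commutative_post_lie (*s) r_bracket p \<longrightarrow>
            (\<exists>B \<in> {B1, B2, B3, B4}. cpa_isomorphic (*s) r_bracket p B))"
proof (intro conjI allI impI)
  show "\<forall>B \<in> {B1, B2, B3, B4}. commutative_post_lie (*s) r_bracket B"
    by (simp add: B_eq_cpa_family commutative_post_lie_cpa_family)
next
  fix p
  assume "commutative_post_lie (*s) r_bracket p"
  then obtain a b c where "p = cpa_family a b c" "c = 0 \<or> c = 1"
    by (rule commutative_post_lie_imp_cpa_family)
  then show "\<exists>B \<in> {B1, B2, B3, B4}. cpa_isomorphic (*s) r_bracket p B"
    using cpa_family_isomorphic_B by blast
qed

end
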